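(* Suppose that $\lambda_1\ge\dots\ge\lambda_{\tilde d}$, $\lambda_d>0$ and $\lambda_d>\lambda_{d+1}$. Let $n\in\{1,\dots,\ell\}$ and let $\sigma\in\mathbb{R}^{\tilde d-d}$ be the vector defined in the context (for this $n$). If $\|\sigma\|_1<1$, then the $n$th iteration of CG on $(\tilde A,\tilde b)$ is well defined, and the associated polynomial $\tilde\varsigma_n=\tilde\pi_n/\tilde\pi_n(0)$ satisfies $$\tilde\varsigma_n=\frac{1}{1-s}\bigg(\varsigma_n-\sum_{j=d+1}^{\tilde d}\sigma_j\,\xi_{n-1}^j\bigg),\qquad\text{where }s=\sum_{j=d+1}^{\tilde d}\sigma_j.$$
   Context: Let $\tilde d\ge d$ be positive integers, $\lambda_1,\dots,\lambda_{\tilde d}\in\mathbb{R}$ and $b_1,\dots,b_{\tilde d}\in\mathbb{R}$. Let $A=\mathrm{diag}(\lambda_1,\dots,\lambda_d)$, $b=(b_1,\dots,b_d)^\top$, $\tilde A=\mathrm{diag}(\lambda_1,\dots,\lambda_{\tilde d})$, $\tilde b=(b_1,\dots,b_{\tilde d})^\top$. For a symmetric matrix $M$ and vector $c$, the $n$th Krylov space is $\mathcal{K}_n(M,c)=\mathrm{span}\{c,Mc,\dots,M^{n-1}c\}$ and the grade is the largest $n$ with $\dim\mathcal{K}_n(M,c)=n$. Let $\ell$ be the grade of $(A,b)$. The $n$th iteration of CG (conjugate gradients started at zero) on $(M,c)$ is well defined if $n$ is at most the grade of $(M,c)$ and $v^\top Mv>0$ for all nonzero $v\in\mathcal{K}_n(M,c)$.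 $\mathcal{P}_{\le n}$ is the space of real univariate polynomials of degree at most $n$. On polynomials define $$\langle p,q\rangle=\sum_{i=1}^d b_i^2p(\lambda_i)q(\lambda_i),\qquad\langle p,q\rangle_\sim=\sum_{i=1}^{\tilde d}b_i^2p(\lambda_i)q(\lambda_i),$$ with induced semi-norms $\|\cdot\|$ and $\|\cdot\|_\sim$. For $n\le\ell$, $\pi_n$ (resp. $\tilde\pi_n$) is the unique minimizer of $\|\pi\|^2$ (resp. $\|\pi\|_\sim^2$) over $\pi\in\mathcal{P}_{\le n}$ whose coefficient of degree $n$ equals $1$. For $d<j\le\tilde d$ and $0\le n<\ell$, $\zeta_n^j$ is the unique minimizer of $\|\zeta\|^2$ over $\zeta\in\mathcal{P}_{\le n}$ subject to $\zeta(\lambda_j)=1$. Under the stated assumptions on the $\lambda_i$, all roots of $\pi_n$ and $\zeta_n^j$ are real and positive; define $\varsigma_n=\pi_n/\pi_n(0)$ and $\xi_n^j=\zeta_n^j/\zeta_n^j(0)$. Definition of $\sigma$ (for a given $n\in\{1,\dots,\ell\}$; indices $i,j$ run over $\{d+1,\dots,\tilde d\}$): $B=\mathrm{diag}(b_{d+1},\dots,b_{\tilde d})$, $C_{ij}=\xi_{n-1}^j(\lambda_i)$, $D$ diagonal with $D_{jj}=\|\xi_{n-1}^j\|^2/\xi_{n-1}^j(\lambda_j)$, $w_i=\varsigma_n(\lambda_i)$, and $\sigma=(D+B^2C)^{-1}B^2w$ (the inverse exists). $\|\sigma\|_1=\sum_j|\sigma_j|$. *)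

theory Defs
  imports
    "HOL-Computational_Algebra.Polynomial"
    "Jordan_Normal_Form.Matrix"
    "Jordan_Normal_Form.VS_Connect"
    "Jordan_Normal_Form.Gauss_Jordan_Elimination"
begin

text \<open>The numbers \<open>\<lambda>\<^sub>1, \<dots>\<close> and \<open>b\<^sub>1, \<dots>\<close> are functions on \<open>nat\<close>, of which only
  the values at \<open>1, \<dots>, m\<close> are used. Vectors and matrices are indexed from \<open>0\<close>.\<close>

definition eig_mat :: "nat \<Rightarrow> (nat \<Rightarrow> real) \<Rightarrow> real mat" where
  "eig_mat m lam = mat_diag m (\<lambda>k. lam (k + 1))"

definition rhs_vec :: "nat \<Rightarrow> (nat \<Rightarrow> real) \<Rightarrow> real vec" where
  "rhs_vec m b = vec m (\<lambda>k. b (k + 1))"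

definition krylov :: "real mat \<Rightarrow> real vec \<Rightarrow> nat \<Rightarrow> real vec set" where
  "krylov M c n = LinearCombinations.module.span class_ring (module_vec TYPE(real) (dim_vec c))
     {(M ^\<^sub>m k) *\<^sub>v c | k. k < n}"

definition krylov_dim :: "real mat \<Rightarrow> real vec \<Rightarrow> nat \<Rightarrow> nat" where
  "krylov_dim M c n = vectorspace.dim class_ring
     ((module_vec TYPE(real) (dim_vec c))\<lparr>carrier := krylov M c n\<rparr>)"

definition grade :: "real mat \<Rightarrow> real vec \<Rightarrow> nat" where
  "grade M c = (GREATEST n. krylov_dim M c n = n)"

definition cg_well_defined :: "real mat \<Rightarrow> real vec \<Rightarrow> nat \<Rightarrow> bool" where
  "cg_well_defined M c n \<longleftrightarrow>
     n \<le> grade M c \<and>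
     (\<forall>v \<in> krylov M c n. v \<noteq> 0\<^sub>v (dim_vec c) \<longrightarrow> v \<bullet> (M *\<^sub>v v) > 0)"

text \<open>With \<open>m = d\<close> this is the inner product without tilde, with \<open>m\<close> the larger dimension
  the one with tilde; likewise for the notions built on it.\<close>

definition poly_ip ::
  "nat \<Rightarrow> (nat \<Rightarrow> real) \<Rightarrow> (nat \<Rightarrow> real) \<Rightarrow> real poly \<Rightarrow> real poly \<Rightarrow> real" where
  "poly_ip m lam b p q = (\<Sum>i=1..m. (b i)^2 * poly p (lam i) * poly q (lam i))"

definition poly_seminorm ::
  "nat \<Rightarrow> (nat \<Rightarrow> real) \<Rightarrow> (nat \<Rightarrow> real) \<Rightarrow> real poly \<Rightarrow> real" where
  "poly_seminorm m lam b p = sqrt (poly_ip m lam b p p)"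

text \<open>The minimizer is unique if \<open>n\<close> is at most the grade of the problem of dimension \<open>m\<close>,
  in particular if \<open>n\<close> is at most the grade of a problem formed by its leading components.\<close>

definition pi_poly ::
  "nat \<Rightarrow> (nat \<Rightarrow> real) \<Rightarrow> (nat \<Rightarrow> real) \<Rightarrow> nat \<Rightarrow> real poly" where
  "pi_poly m lam b n =
     (THE p. is_arg_min (\<lambda>q. (poly_seminorm m lam b q)^2)
               (\<lambda>q. degree q \<le> n \<and> coeff q n = 1) p)"

text \<open>The minimizer is unique if \<open>n\<close> is less than the grade of the problem of dimension \<open>m\<close>.\<close>

definition zeta_poly ::
  "nat \<Rightarrow> (nat \<Rightarrow> real) \<Rightarrow> (nat \<Rightarrow> real) \<Rightarrow> nat \<Rightarrow> nat \<Rightarrow> real poly" where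
  "zeta_poly m lam b n j =
     (THE p. is_arg_min (\<lambda>q. (poly_seminorm m lam b q)^2)
               (\<lambda>q. degree q \<le> n \<and> poly q (lam j) = 1) p)"

text \<open>A minimizer vanishing at \<open>0\<close> gives the zero polynomial here. This does not
  happen if the first \<open>m\<close> eigenvalues are positive and, for \<open>xi_poly\<close>, \<open>lam j\<close> is smaller
  than all of them: then all roots of the minimizer are positive.\<close>

definition varsigma_poly ::
  "nat \<Rightarrow> (nat \<Rightarrow> real) \<Rightarrow> (nat \<Rightarrow> real) \<Rightarrow> nat \<Rightarrow> real poly" where
  "varsigma_poly m lam b n =
     Polynomial.smult (1 / poly (pi_poly m lam b n) 0) (pi_poly m lam b n)"

definition xi_poly ::
  "nat \<Rightarrow> (nat \<Rightarrow> real) \<Rightarrow> (nat \<Rightarrow> real) \<Rightarrow> nat \<Rightarrow> nat \<Rightarrow> real poly" where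
  "xi_poly m lam b n j =
     Polynomial.smult (1 / poly (zeta_poly m lam b n j) 0) (zeta_poly m lam b n j)"

text \<open>Position \<open>k\<close> in the following vectors and matrices corresponds to the
  index \<open>j = d + 1 + k\<close>. The argument \<open>dt\<close> is the larger dimension.\<close>

definition B_mat :: "nat \<Rightarrow> nat \<Rightarrow> (nat \<Rightarrow> real) \<Rightarrow> real mat" where
  "B_mat d dt b = mat_diag (dt - d) (\<lambda>k. b (d + 1 + k))"

definition C_mat ::
  "nat \<Rightarrow> nat \<Rightarrow> (nat \<Rightarrow> real) \<Rightarrow> (nat \<Rightarrow> real) \<Rightarrow> nat \<Rightarrow> real mat" where
  "C_mat d dt lam b n =
     mat (dt - d) (dt - d)
       (\<lambda>(i, j). poly (xi_poly d lam b (n - 1) (d + 1 + j)) (lam (d + 1 + i)))"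

definition D_mat ::
  "nat \<Rightarrow> nat \<Rightarrow> (nat \<Rightarrow> real) \<Rightarrow> (nat \<Rightarrow> real) \<Rightarrow> nat \<Rightarrow> real mat" where
  "D_mat d dt lam b n =
     mat_diag (dt - d)
       (\<lambda>k. (poly_seminorm d lam b (xi_poly d lam b (n - 1) (d + 1 + k)))^2
            / poly (xi_poly d lam b (n - 1) (d + 1 + k)) (lam (d + 1 + k)))"

definition w_vec ::
  "nat \<Rightarrow> nat \<Rightarrow> (nat \<Rightarrow> real) \<Rightarrow> (nat \<Rightarrow> real) \<Rightarrow> nat \<Rightarrow> real vec" where
  "w_vec d dt lam b n =
     vec (dt - d) (\<lambda>k. poly (varsigma_poly d lam b n) (lam (d + 1 + k)))"

text \<open>The inverse exists in the intended situation. \<open>mat_inverse\<close> is \<open>None\<close> on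
  singular matrices.\<close>

definition sigma_vec ::
  "nat \<Rightarrow> nat \<Rightarrow> (nat \<Rightarrow> real) \<Rightarrow> (nat \<Rightarrow> real) \<Rightarrow> nat \<Rightarrow> real vec" where
  "sigma_vec d dt lam b n =
     the (mat_inverse (D_mat d dt lam b n + (B_mat d dt b ^\<^sub>m 2) * C_mat d dt lam b n))
       *\<^sub>v ((B_mat d dt b ^\<^sub>m 2) *\<^sub>v w_vec d dt lam b n)"

definition vec_norm1 :: "real vec \<Rightarrow> real" where
  "vec_norm1 v = (\<Sum>k<dim_vec v. \<bar>v $ k\<bar>)"

end

theory Submission
  imports Defs "HOL-Computational_Algebra.Fundamental_Theorem_Algebra"
    "Jordan_Normal_Form.Char_Poly" "Jordan_Normal_Form.DL_Rank"
begin

text \<open>Polynomials of degree less than \<open>n\<close> have a reproducing kernel for the inner product without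
  tilde, and \<open>\<xi>\<close> for the index \<open>j\<close> is the kernel at \<open>\<lambda>\<^sub>j\<close> normalized at \<open>0\<close>. The linear system
  for \<open>\<sigma>\<close> says exactly that \<open>p = \<varsigma> - \<Sum>\<^sub>j \<sigma>\<^sub>j \<xi>\<^sub>j\<close> is orthogonal with tilde to all of them, so \<open>p\<close>
  is a multiple of the minimizer with tilde. Sign arguments give \<open>0 < \<xi>\<^sub>j \<le> \<varsigma>\<close> on the
  nonpositive axis, hence \<open>p > 0\<close> there. All roots of the orthogonal polynomial \<open>p\<close> are real and
  simple, now also positive, and by Gaussian quadrature this is positive definiteness of the matrix
  with tilde on the Krylov space.\<close>

subsection \<open>The discrete inner product\<close>

text \<open>Vanishing coefficients instead of a degree bound make \<open>n = 0\<close> the zero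
  space and turn closure under linear operations into a coefficientwise fact.\<close>

definition polys_lt :: "nat \<Rightarrow> real poly set" where
  "polys_lt n = {q. \<forall>k\<ge>n. coeff q k = 0}"

text \<open>The working form of the condition that \<open>n\<close> is at most the grade;
  \<open>le_grade_iff\<close> proves the equivalence.\<close>

definition ip_posdef :: "nat \<Rightarrow> (nat \<Rightarrow> real) \<Rightarrow> (nat \<Rightarrow> real) \<Rightarrow> nat \<Rightarrow> bool" where
  "ip_posdef m lam b n \<longleftrightarrow> (\<forall>q\<in>polys_lt n. poly_ip m lam b q q = 0 \<longrightarrow> q = 0)"

lemma polys_lt_iff: "q \<in> polys_lt n \<longleftrightarrow> q = 0 \<or> degree q < n"
  unfolding polys_lt_def
  by (auto simp: coeff_eq_0 degree_lessI) (metis leading_coeff_0_iff not_le)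

lemma polys_lt_closed [intro]:
  "0 \<in> polys_lt n"
  "p \<in> polys_lt n \<Longrightarrow> q \<in> polys_lt n \<Longrightarrow> p + q \<in> polys_lt n"
  "p \<in> polys_lt n \<Longrightarrow> q \<in> polys_lt n \<Longrightarrow> p - q \<in> polys_lt n"
  "p \<in> polys_lt n \<Longrightarrow> Polynomial.smult c p \<in> polys_lt n"
  by (auto simp: polys_lt_def)

lemma polys_lt_sum [intro]:
  "(\<And>i. i \<in> A \<Longrightarrow> f i \<in> polys_lt n) \<Longrightarrow> sum f A \<in> polys_lt n"
  by (induction A rule: infinite_finite_induct) auto

lemma polys_lt_mono: "p \<in> polys_lt n \<Longrightarrow> n \<le> k \<Longrightarrow> p \<in> polys_lt k"
  by (auto simp: polys_lt_def)

lemma polys_lt_linear_factor: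
  assumes "[:a, 1:] * q \<in> polys_lt n"
  shows "q \<in> polys_lt (n - 1)"
proof (cases "q = 0")
  case False
  then have "degree ([:a, 1:] * q) = Suc (degree q)"
    by (subst degree_mult_eq) auto
  moreover have "[:a, 1:] * q \<noteq> 0"
    using False by (metis mult_eq_0_iff pCons_eq_0_iff one_neq_zero)
  ultimately show ?thesis using assms False by (auto simp: polys_lt_iff)
qed auto

lemma linear_factor_mult_polys_lt:
  assumes "q \<in> polys_lt n"
  shows "[:a, 1:] * q \<in> polys_lt (Suc n)"
proof (cases "q = 0")
  case False
  then have "degree ([:a, 1:] * q) = Suc (degree q)"
    by (subst degree_mult_eq) auto
  then show ?thesis using assms False by (auto simp: polys_lt_iff)
qed auto

lemma poly_ip_commute: "poly_ip m lam b p q = poly_ip m lam b q p"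
  unfolding poly_ip_def by (intro sum.cong) (auto simp: mult_ac)

lemma poly_ip_linear:
  "poly_ip m lam b (p + p') q = poly_ip m lam b p q + poly_ip m lam b p' q"
  "poly_ip m lam b (p - p') q = poly_ip m lam b p q - poly_ip m lam b p' q"
  "poly_ip m lam b (Polynomial.smult c p) q = c * poly_ip m lam b p q"
  "poly_ip m lam b p (q + q') = poly_ip m lam b p q + poly_ip m lam b p q'"
  "poly_ip m lam b p (q - q') = poly_ip m lam b p q - poly_ip m lam b p q'"
  "poly_ip m lam b p (Polynomial.smult c q) = c * poly_ip m lam b p q"
  "poly_ip m lam b 0 q = 0" "poly_ip m lam b p 0 = 0"
  unfolding poly_ip_def
  by (auto simp: algebra_simps sum.distrib sum_subtractf sum_distrib_left)

lemma poly_ip_sum: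
  "poly_ip m lam b (\<Sum>i\<in>A. f i) q = (\<Sum>i\<in>A. poly_ip m lam b (f i) q)"
  "poly_ip m lam b p (\<Sum>i\<in>A. f i) = (\<Sum>i\<in>A. poly_ip m lam b p (f i))"
  by (induction A rule: infinite_finite_induct) (auto simp: poly_ip_linear)

lemma poly_ip_mult_left: "poly_ip m lam b (g * p) q = poly_ip m lam b p (g * q)"
  unfolding poly_ip_def by (intro sum.cong) (auto simp: mult_ac)

lemma poly_ip_self: "poly_ip m lam b q q = (\<Sum>i=1..m. (b i * poly q (lam i))\<^sup>2)"
  unfolding poly_ip_def by (intro sum.cong) (auto simp: power2_eq_square mult_ac)

lemma poly_ip_nonneg [simp]: "poly_ip m lam b q q \<ge> 0"
  unfolding poly_ip_self by (intro sum_nonneg) auto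

lemma poly_ip_weighted:
  "poly_ip m lam b (g * q) q = (\<Sum>i=1..m. poly g (lam i) * (b i * poly q (lam i))\<^sup>2)"
  unfolding poly_ip_def by (intro sum.cong) (auto simp: power2_eq_square mult_ac)

lemma poly_seminorm_sq: "(poly_seminorm m lam b p)\<^sup>2 = poly_ip m lam b p p"
  unfolding poly_seminorm_def by simp

lemma ip_posdef_pos:
  "ip_posdef m lam b n \<Longrightarrow> q \<in> polys_lt n \<Longrightarrow> q \<noteq> 0 \<Longrightarrow> poly_ip m lam b q q > 0"
  unfolding ip_posdef_def by (metis poly_ip_nonneg less_eq_real_def)

lemma ip_posdef_mono: "ip_posdef m lam b n \<Longrightarrow> k \<le> n \<Longrightarrow> ip_posdef m lam b k"
  unfolding ip_posdef_def using polys_lt_mono by blast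

text \<open>The form is nonzero at \<open>q\<close>, so some node carries a nonzero term. The root
  exclusions below apply this with \<open>g\<close> a product of factors positive at the
  nodes.\<close>

lemma weighted_ip_pos:
  assumes "ip_posdef m lam b n" "q \<in> polys_lt n" "q \<noteq> 0"
    and g: "\<And>i. i \<in> {1..m} \<Longrightarrow> poly g (lam i) > 0"
  shows "poly_ip m lam b (g * q) q > 0"
proof -
  have "\<not> (\<forall>i\<in>{1..m}. b i * poly q (lam i) = 0)"
  proof
    assume "\<forall>i\<in>{1..m}. b i * poly q (lam i) = 0"
    then have "poly_ip m lam b q q = 0" unfolding poly_ip_self by (intro sum.neutral) simp
    then show False using ip_posdef_pos[OF assms(1-3)] by simp
  qed
  then obtain i where i: "i \<in> {1..m}" "b i * poly q (lam i) \<noteq> 0"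
    by blast
  show ?thesis
    unfolding poly_ip_weighted
  proof (rule sum_pos2[of _ i])
    show "0 < poly g (lam i) * (b i * poly q (lam i))\<^sup>2"
      using g[OF i(1)] i(2) by (intro mult_pos_pos) (simp_all only: zero_less_power2 not_False_eq_True)
    show "0 \<le> poly g (lam k) * (b k * poly q (lam k))\<^sup>2" if "k \<in> {1..m}" for k
      using g[OF that] by (intro mult_nonneg_nonneg zero_le_power2 less_imp_le)
  qed (use i in auto)
qed

text \<open>Gram-Schmidt by induction: the representer for degree below \<open>n\<close> is
  corrected by a multiple of the orthogonal polynomial of degree \<open>n\<close>. It serves for
  projections of monomials and for point evaluations.\<close>

lemma poly_ip_riesz:
  fixes L :: "real poly \<Rightarrow> real"
  assumes "ip_posdef m lam b n"
    and add: "\<And>p q. L (p + q) = L p + L q"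
    and smult: "\<And>c p. L (Polynomial.smult c p) = c * L p"
  shows "\<exists>K\<in>polys_lt n. \<forall>q\<in>polys_lt n. poly_ip m lam b K q = L q"
  using assms
proof (induction n arbitrary: L)
  case 0
  have "L 0 = 0" using 0(3)[of 0 0] by simp
  then show ?case by (auto simp: polys_lt_iff poly_ip_linear)
next
  case (Suc n)
  have pd: "ip_posdef m lam b n" using Suc.prems(1) by (rule ip_posdef_mono) simp
  obtain r where r: "r \<in> polys_lt n"
      "\<And>q. q \<in> polys_lt n \<Longrightarrow> poly_ip m lam b r q = poly_ip m lam b (monom 1 n) q"
    using Suc.IH[OF pd, of "poly_ip m lam b (monom 1 n)"] by (auto simp: poly_ip_linear)
  obtain K0 where K0: "K0 \<in> polys_lt n" "\<And>q. q \<in> polys_lt n \<Longrightarrow> poly_ip m lam b K0 q = L q"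
    using Suc.IH[OF pd, of L] Suc.prems(2,3) by auto
  \<comment> \<open>The monomial minus its projection: the monic orthogonal polynomial of degree
    \<open>n\<close>.\<close>
  define u where "u = monom 1 n - r"
  have cu: "coeff u n = 1" using r(1) by (auto simp: u_def polys_lt_def)
  have u: "u \<in> polys_lt (Suc n)"
    using r(1) by (auto simp: u_def polys_lt_def)
  have uo: "poly_ip m lam b u q = 0" if "q \<in> polys_lt n" for q
    using r(2)[OF that] by (simp add: u_def poly_ip_linear)
  have "u \<noteq> 0" using cu by auto
  then have uu: "poly_ip m lam b u u > 0" by (rule ip_posdef_pos[OF Suc.prems(1) u])
  \<comment> \<open>As \<open>u\<close> is orthogonal to \<open>polys_lt n\<close>, the correction
    leaves the values there intact; \<open>K0\<close> pairs to zero with \<open>u\<close>, so the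
    value \<open>L u\<close> forces the coefficient.\<close>
  define K where "K = K0 + Polynomial.smult (L u / poly_ip m lam b u u) u"
  have K0u: "poly_ip m lam b K0 u = 0" using uo[OF K0(1)] by (simp add: poly_ip_commute)
  have "K \<in> polys_lt (Suc n)"
    using u polys_lt_mono[OF K0(1), of "Suc n"] by (auto simp: K_def)
  moreover have "poly_ip m lam b K q = L q" if q: "q \<in> polys_lt (Suc n)" for q
  proof -
    define q' where "q' = q - Polynomial.smult (coeff q n) u"
    have "coeff q' k = 0" if "k \<ge> n" for k
      using that q u cu by (cases "k = n") (auto simp: q'_def polys_lt_def)
    then have q': "q' \<in> polys_lt n" by (auto simp: polys_lt_def)
    have qe: "q = q' + Polynomial.smult (coeff q n) u" by (simp add: q'_def)
    have "poly_ip m lam b K q = poly_ip m lam b K q' + coeff q n * poly_ip m lam b K u"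
      by (subst qe) (simp only: poly_ip_linear)
    also have "poly_ip m lam b K q' = L q'"
      using K0(2)[OF q'] uo[OF q'] by (simp add: K_def poly_ip_linear)
    also have "poly_ip m lam b K u = L u"
      using K0u uu by (simp add: K_def poly_ip_linear)
    also have "L q' + coeff q n * L u = L q"
      by (subst (2) qe) (simp only: Suc.prems(2,3))
    finally show ?thesis .
  qed
  ultimately show ?case by blast
qed

subsection \<open>The minimizers\<close>

lemma arg_min_the_eq:
  assumes "P p" "\<And>q. P q \<Longrightarrow> q \<noteq> p \<Longrightarrow> (f p :: real) < f q"
  shows "(THE p. is_arg_min f P p) = p"
proof (rule the_equality)
  show "is_arg_min f P p"
    using assms by (auto simp: is_arg_min_def) (metis less_asym)
  show "q = p" if "is_arg_min f P q" for q
    using assms that unfolding is_arg_min_def by blast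
qed

text \<open>Pythagoras: a competitor differs from \<open>p\<close> by some \<open>r\<close> of
  degree below \<open>n\<close>, which is orthogonal to \<open>p\<close>, so its squared norm
  exceeds that of \<open>p\<close> by that of \<open>r\<close>.\<close>

lemma pi_poly_eqI:
  assumes pd: "ip_posdef m lam b n" and p: "degree p \<le> n" "coeff p n = 1"
    and orth: "\<And>q. q \<in> polys_lt n \<Longrightarrow> poly_ip m lam b p q = 0"
  shows "pi_poly m lam b n = p"
  unfolding pi_poly_def
proof (rule arg_min_the_eq)
  fix q assume q: "degree q \<le> n \<and> coeff q n = 1" "q \<noteq> p"
  define r where "r = q - p"
  have "coeff r k = 0" if "k \<ge> n" for k
    using that p q by (cases "k = n") (auto simp: r_def coeff_eq_0)
  then have r: "r \<in> polys_lt n" by (auto simp: polys_lt_def)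
  have "r \<noteq> 0" using q by (simp add: r_def)
  then have "poly_ip m lam b r r > 0" by (rule ip_posdef_pos[OF pd r])
  moreover have "q = p + r" by (simp add: r_def)
  ultimately show "(poly_seminorm m lam b p)\<^sup>2 < (poly_seminorm m lam b q)\<^sup>2"
    using orth[OF r] by (simp add: poly_seminorm_sq poly_ip_linear poly_ip_commute)
qed (use p in auto)

lemma pi_poly_props:
  assumes pd: "ip_posdef m lam b n"
  shows "degree (pi_poly m lam b n) \<le> n" "coeff (pi_poly m lam b n) n = 1"
    and "\<And>q. q \<in> polys_lt n \<Longrightarrow> poly_ip m lam b (pi_poly m lam b n) q = 0"
proof -
  obtain r where r: "r \<in> polys_lt n"
      "\<And>q. q \<in> polys_lt n \<Longrightarrow> poly_ip m lam b r q = poly_ip m lam b (monom 1 n) q"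
    using poly_ip_riesz[OF pd, of "poly_ip m lam b (monom 1 n)"] by (auto simp: poly_ip_linear)
  define p where "p = monom 1 n - r"
  have p: "degree p \<le> n" "coeff p n = 1"
    using r(1) by (auto simp: p_def polys_lt_def intro!: degree_le)
  have orth: "poly_ip m lam b p q = 0" if "q \<in> polys_lt n" for q
    using r(2)[OF that] by (simp add: p_def poly_ip_linear)
  have "pi_poly m lam b n = p" by (rule pi_poly_eqI[OF pd p orth])
  then show "degree (pi_poly m lam b n) \<le> n" "coeff (pi_poly m lam b n) n = 1"
    "\<And>q. q \<in> polys_lt n \<Longrightarrow> poly_ip m lam b (pi_poly m lam b n) q = 0"
    using p orth by auto
qed

text \<open>\<open>K\<close> is the section at \<open>z\<close> of the reproducing
  (Christoffel-Darboux) kernel.\<close>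

definition is_kernel ::
  "nat \<Rightarrow> (nat \<Rightarrow> real) \<Rightarrow> (nat \<Rightarrow> real) \<Rightarrow> nat \<Rightarrow> real \<Rightarrow> real poly \<Rightarrow> bool" where
  "is_kernel m lam b n z K \<longleftrightarrow>
     K \<in> polys_lt n \<and> (\<forall>q\<in>polys_lt n. poly_ip m lam b K q = poly q z)"

lemma ex_kernel: "ip_posdef m lam b n \<Longrightarrow> \<exists>K. is_kernel m lam b n z K"
  using poly_ip_riesz[of m lam b n "\<lambda>p. poly p z"] unfolding is_kernel_def by auto

lemma is_kernelD:
  assumes "is_kernel m lam b n z K"
  shows "K \<in> polys_lt n" "\<And>q. q \<in> polys_lt n \<Longrightarrow> poly_ip m lam b K q = poly q z"
  using assms by (auto simp: is_kernel_def)

text \<open>Reproduction makes \<open>poly K z\<close> the squared norm of \<open>K\<close>, and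
  pairing with the constant 1, available since \<open>n \<ge> 1\<close>, shows that \<open>K\<close>
  is nonzero.\<close>

lemma kernel_diag_pos:
  assumes pd: "ip_posdef m lam b n" and n: "n \<ge> 1" and K: "is_kernel m lam b n z K"
  shows "poly K z > 0"
proof -
  have "1 \<in> polys_lt n" using n by (auto simp: polys_lt_iff)
  then have "poly_ip m lam b K 1 = 1" using is_kernelD(2)[OF K, of 1] by simp
  then have "K \<noteq> 0" by (auto simp: poly_ip_linear)
  then have "poly_ip m lam b K K > 0" by (rule ip_posdef_pos[OF pd is_kernelD(1)[OF K]])
  then show ?thesis using is_kernelD(2)[OF K is_kernelD(1)[OF K]] by simp
qed

text \<open>Two admissible polynomials differ by one that vanishes at \<open>lam j\<close>; the
  kernel is orthogonal to it, and Pythagoras applies again.\<close>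

lemma zeta_poly_eq_kernel:
  assumes pd: "ip_posdef m lam b n" and n: "n \<ge> 1" and K: "is_kernel m lam b n (lam j) K"
  shows "zeta_poly m lam b (n - 1) j = Polynomial.smult (1 / poly K (lam j)) K"
  unfolding zeta_poly_def
proof (rule arg_min_the_eq)
  let ?z = "Polynomial.smult (1 / poly K (lam j)) K"
  have Kj: "poly K (lam j) > 0" by (rule kernel_diag_pos[OF pd n K])
  have lt: "q \<in> polys_lt n \<longleftrightarrow> degree q \<le> n - 1" for q
    using n by (auto simp: polys_lt_iff)
  show "degree ?z \<le> n - 1 \<and> poly ?z (lam j) = 1"
    using is_kernelD(1)[OF K] Kj by (simp add: lt)
  fix q assume q: "degree q \<le> n - 1 \<and> poly q (lam j) = 1" "q \<noteq> ?z"
  define r where "r = q - ?z"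
  have r: "r \<in> polys_lt n"
    using q is_kernelD(1)[OF K] unfolding r_def lt[symmetric] by auto
  have "r \<noteq> 0" using q by (simp add: r_def)
  then have "poly_ip m lam b r r > 0" by (rule ip_posdef_pos[OF pd r])
  moreover have "q = ?z + r" by (simp add: r_def)
  moreover have "poly_ip m lam b ?z r = 0"
    using is_kernelD(2)[OF K r] q Kj by (simp add: poly_ip_linear r_def)
  ultimately show "(poly_seminorm m lam b ?z)\<^sup>2 < (poly_seminorm m lam b q)\<^sup>2"
    by (auto simp: poly_seminorm_sq poly_ip_linear poly_ip_commute)
qed

lemma xi_poly_eq_kernel:
  assumes pd: "ip_posdef m lam b n" and n: "n \<ge> 1" and K: "is_kernel m lam b n (lam j) K"
  shows "xi_poly m lam b (n - 1) j = Polynomial.smult (1 / poly K 0) K"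
  using kernel_diag_pos[OF assms]
  unfolding xi_poly_def zeta_poly_eq_kernel[OF assms] by simp

subsection \<open>Signs below the smallest node\<close>

lemma poly_same_sign:
  fixes p :: "real poly"
  assumes "\<And>x. x < c \<Longrightarrow> poly p x \<noteq> 0" "x < c" "y < c" "poly p y > 0"
  shows "poly p x > 0"
proof (rule ccontr)
  assume "\<not> poly p x > 0"
  with assms(1)[OF assms(2)] have neg: "poly p x < 0" by simp
  then have "x \<noteq> y" using assms(4) by auto
  then consider "x < y" | "y < x" by linarith
  then show False
  proof cases
    case 1
    with poly_IVT_pos[OF 1 neg assms(4)] assms(1,3) show False by force
  next
    case 2
    with poly_IVT_neg[OF 2 assms(4) neg] assms(1,2) show False by force
  qed
qed

text \<open>Splitting off a root \<open>r\<close> leaves a cofactor \<open>q\<close> of lower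
  degree; orthogonality to \<open>q\<close> contradicts the positive weight
  \<open>X - r\<close>.\<close>

lemma pi_poly_no_root_below:
  assumes pd: "ip_posdef m lam b n"
    and c: "\<forall>i\<in>{1..m}. c \<le> lam i" and r: "r < c"
  shows "poly (pi_poly m lam b n) r \<noteq> 0"
proof
  let ?p = "pi_poly m lam b n"
  assume "poly ?p r = 0"
  then obtain q where q: "?p = [:-r, 1:] * q" by (metis dvdE poly_eq_0_iff_dvd)
  have "?p \<noteq> 0" using pi_poly_props(2)[OF pd] by auto
  then have "q \<noteq> 0" using q by auto
  have "?p \<in> polys_lt (Suc n)" using pi_poly_props(1)[OF pd] by (auto simp: polys_lt_iff)
  then have qn: "q \<in> polys_lt n" using q polys_lt_linear_factor[of "-r" q "Suc n"] by simp
  have "poly_ip m lam b ([:-r, 1:] * q) q > 0"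
    by (rule weighted_ip_pos[OF pd qn \<open>q \<noteq> 0\<close>]) (use c r in force)
  then show False using pi_poly_props(3)[OF pd qn] q by simp
qed

text \<open>With \<open>K = (X - r) q\<close>, the test polynomial \<open>(X - z) q\<close> vanishes
  at \<open>z\<close> and so is orthogonal to \<open>K\<close>, yet the weight
  \<open>(X - z) (X - r)\<close> is positive at the nodes.\<close>

lemma kernel_no_root_below:
  assumes pd: "ip_posdef m lam b n" and n: "n \<ge> 1" and K: "is_kernel m lam b n z K"
    and c: "\<forall>i\<in>{1..m}. c \<le> lam i" and z: "z < c" and r: "r < c"
  shows "poly K r \<noteq> 0"
proof
  assume "poly K r = 0"
  then obtain q where q: "K = [:-r, 1:] * q" by (metis dvdE poly_eq_0_iff_dvd)
  have "K \<noteq> 0" using kernel_diag_pos[OF pd n K] by auto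
  then have "q \<noteq> 0" using q by auto
  \<comment> \<open>The sharper bound leaves room for the factor \<open>X - z\<close> inside
    \<open>polys_lt n\<close>.\<close>
  have qn1: "q \<in> polys_lt (n - 1)"
    using q polys_lt_linear_factor is_kernelD(1)[OF K] by blast
  then have qn: "q \<in> polys_lt n" by (rule polys_lt_mono) simp
  have t: "[:-z, 1:] * q \<in> polys_lt n" using linear_factor_mult_polys_lt[OF qn1, of "-z"] n by simp
  have "poly_ip m lam b (([:-z, 1:] * [:-r, 1:]) * q) q > 0"
  proof (rule weighted_ip_pos[OF pd qn \<open>q \<noteq> 0\<close>])
    fix i assume "i \<in> {1..m}"
    from bspec[OF c this] have "(lam i - z) * (lam i - r) > 0" using z r by auto
    then show "poly ([:-z, 1:] * [:-r, 1:]) (lam i) > 0" by (simp add: algebra_simps)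
  qed
  also have "poly_ip m lam b (([:-z, 1:] * [:-r, 1:]) * q) q
      = poly_ip m lam b K ([:-z, 1:] * q)"
    unfolding q mult.assoc by (rule poly_ip_mult_left)
  also have "\<dots> = 0" unfolding is_kernelD(2)[OF K t] by simp
  finally show False by simp
qed

lemma kernel_pos_below:
  assumes pd: "ip_posdef m lam b n" and n: "n \<ge> 1" and K: "is_kernel m lam b n z K"
    and c: "\<forall>i\<in>{1..m}. c \<le> lam i" and z: "z < c" and x: "x < c"
  shows "poly K x > 0"
  using poly_same_sign[OF _ x z kernel_diag_pos[OF pd n K]] kernel_no_root_below[OF assms(1-5)]
  by blast

lemma varsigma_poly_pos_below:
  assumes pd: "ip_posdef m lam b n"
    and c: "\<forall>i\<in>{1..m}. c \<le> lam i" and "0 < c" and x: "x < c"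
  shows "poly (varsigma_poly m lam b n) x > 0"
proof -
  note nr = pi_poly_no_root_below[OF pd c]
  show ?thesis
    by (rule poly_same_sign[of c _ x 0]) (use nr assms(3) x in \<open>auto simp: varsigma_poly_def\<close>)
qed

lemma varsigma_poly_props:
  assumes pd: "ip_posdef m lam b n"
    and c: "\<forall>i\<in>{1..m}. c \<le> lam i" and "0 < c"
  shows "degree (varsigma_poly m lam b n) \<le> n" "coeff (varsigma_poly m lam b n) n \<noteq> 0"
    "poly (varsigma_poly m lam b n) 0 = 1"
    and "\<And>q. q \<in> polys_lt n \<Longrightarrow> poly_ip m lam b (varsigma_poly m lam b n) q = 0"
  using pi_poly_no_root_below[OF pd c \<open>0 < c\<close>] pi_poly_props[OF pd]
  by (auto simp: varsigma_poly_def poly_ip_linear)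

text \<open>The difference \<open>h\<close> vanishes at 0, so \<open>h = X g\<close>. Testing
  \<open>h\<close> with \<open>g\<close> gives \<open>g\<close> a negative value at
  \<open>z\<close>, and \<open>g\<close> has no root below \<open>c\<close>. Thus \<open>g\<close>
  is negative there and \<open>h\<close> is nonnegative for \<open>x \<le> 0\<close>.\<close>

lemma xi_le_varsigma:
  assumes pd: "ip_posdef m lam b n" and n: "n \<ge> 1" and K: "is_kernel m lam b n z K"
    and c: "\<forall>i\<in>{1..m}. c \<le> lam i" and "0 < c" and z: "z < c" and x: "x \<le> 0"
  shows "poly K x / poly K 0 \<le> poly (varsigma_poly m lam b n) x"
proof -
  let ?v = "varsigma_poly m lam b n"
  note v = varsigma_poly_props[OF pd c \<open>0 < c\<close>]
  have K0: "poly K 0 > 0" using kernel_pos_below[OF pd n K c z \<open>0 < c\<close>] .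
  define h where "h = ?v - Polynomial.smult (1 / poly K 0) K"
  have Kn: "K \<in> polys_lt n" by (rule is_kernelD(1)[OF K])
  \<comment> \<open>\<open>K\<close> has degree below \<open>n\<close>, so the leading term of
    \<open>varsigma_poly\<close> survives.\<close>
  have hn: "coeff h n \<noteq> 0" using v(2) Kn by (auto simp: h_def polys_lt_def)
  then have "h \<noteq> 0" by auto
  have "poly h 0 = 0" using K0 v(3) by (simp add: h_def)
  then have "[:-0, 1:] dvd h" by (simp only: poly_eq_0_iff_dvd)
  then obtain g where g: "h = [:-0, 1:] * g" by (rule dvdE)
  have "g \<noteq> 0" using g \<open>h \<noteq> 0\<close> by auto
  have "h \<in> polys_lt (Suc n)"
    unfolding h_def using v(1) polys_lt_mono[OF Kn, of "Suc n"]
    by (intro polys_lt_closed) (auto simp: polys_lt_iff)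
  then have gn: "g \<in> polys_lt n" using polys_lt_linear_factor[of "-0" g "Suc n"] g by simp
  have hip: "poly_ip m lam b h q = - poly q z / poly K 0" if "q \<in> polys_lt n" for q
    using v(4)[OF that] is_kernelD(2)[OF K that] by (simp add: h_def poly_ip_linear)
  have "poly_ip m lam b ([:-0, 1:] * g) g > 0"
    by (rule weighted_ip_pos[OF pd gn \<open>g \<noteq> 0\<close>]) (use c \<open>0 < c\<close> in force)
  then have "- poly g z / poly K 0 > 0" using hip[OF gn] g by simp
  then have gz: "poly (- g) z > 0" using K0 by (auto simp: divide_less_0_iff)
  \<comment> \<open>The argument of \<open>kernel_no_root_below\<close> with the additional positive
    weight \<open>X\<close>.\<close>
  have "poly (- g) r \<noteq> 0" if r: "r < c" for r
  proof
    assume "poly (- g) r = 0"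
    then have "poly g r = 0" by simp
    then obtain q where q: "g = [:-r, 1:] * q" by (metis dvdE poly_eq_0_iff_dvd)
    then have "q \<noteq> 0" using \<open>g \<noteq> 0\<close> by auto
    have qn1: "q \<in> polys_lt (n - 1)" using polys_lt_linear_factor gn q by blast
    then have qn: "q \<in> polys_lt n" by (rule polys_lt_mono) simp
    have t: "[:-z, 1:] * q \<in> polys_lt n" using linear_factor_mult_polys_lt[OF qn1, of "-z"] n by simp
    have "poly_ip m lam b (([:-z, 1:] * [:-0, 1:] * [:-r, 1:]) * q) q > 0"
    proof (rule weighted_ip_pos[OF pd qn \<open>q \<noteq> 0\<close>])
      fix i assume "i \<in> {1..m}"
      from bspec[OF c this] have "(lam i - z) * lam i * (lam i - r) > 0" using z r \<open>0 < c\<close> by auto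
      then show "poly ([:-z, 1:] * [:-0, 1:] * [:-r, 1:]) (lam i) > 0" by (simp add: algebra_simps)
    qed
    also have "poly_ip m lam b (([:-z, 1:] * [:-0, 1:] * [:-r, 1:]) * q) q
        = poly_ip m lam b h ([:-z, 1:] * q)"
      unfolding g q mult.assoc by (rule poly_ip_mult_left)
    also have "\<dots> = 0" using hip[OF t] by simp
    finally show False by simp
  qed
  then have "poly (- g) x > 0"
    by (rule poly_same_sign[of c _ x z]) (use z gz x \<open>0 < c\<close> in auto)
  then have "poly h x \<ge> 0" using x unfolding g by (simp add: mult_nonpos_nonpos)
  then show ?thesis by (simp add: h_def)
qed

subsection \<open>Gaussian quadrature\<close>

text \<open>\<open>?Q\<close> is the product of \<open>X - z\<close> and its conjugate. The
  remainder modulo \<open>?Q\<close> is real and at most linear, and vanishing at a nonreal point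
  makes it zero.\<close>

lemma nonreal_root_quadratic_dvd:
  fixes p :: "real poly"
  assumes z: "poly (map_poly complex_of_real p) z = 0" and "Im z \<noteq> 0"
  shows "[:(Re z)\<^sup>2 + (Im z)\<^sup>2, - 2 * Re z, 1:] dvd p" (is "?Q dvd p")
proof -
  interpret h: map_poly_inj_idom_hom complex_of_real ..
  define r where "r = p mod ?Q"
  have "degree r < 2" using degree_mod_less'[of ?Q p] by (cases "r = 0") (auto simp: r_def)
  then obtain u v where r: "r = [:u, v:]" by (metis degree1_coeffs degree_0_id less_2_cases pCons_0_0 One_nat_def)
  have Qz: "poly (map_poly complex_of_real ?Q) z = 0"
    by (simp add: complex_eq_iff power2_eq_square algebra_simps)
  have "p = ?Q * (p div ?Q) + r" unfolding r_def by (rule mult_div_mod_eq[symmetric])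
  then have "poly (map_poly complex_of_real p) z =
      poly (map_poly complex_of_real ?Q) z * poly (map_poly complex_of_real (p div ?Q)) z
      + poly (map_poly complex_of_real r) z"
    by (metis h.hom_add h.hom_mult poly_add poly_mult)
  then have "poly (map_poly complex_of_real r) z = 0" using z Qz by simp
  then have "of_real u + z * of_real v = 0" by (simp add: r of_real_hom.map_poly_pCons_hom)
  then have "u = 0" "v = 0" using \<open>Im z \<noteq> 0\<close> by (auto simp: complex_eq_iff)
  then show ?thesis using r by (simp add: r_def mod_eq_0_iff_dvd)
qed

lemma prod_linear_factors_dvd:
  fixes p :: "'a :: idom poly"
  assumes "finite R" "\<And>x. x \<in> R \<Longrightarrow> poly p x = 0"
  shows "(\<Prod>x\<in>R. [:-x, 1:]) dvd p"
  using assms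
proof (induction R arbitrary: p rule: finite_induct)
  case (insert a R)
  obtain q where q: "p = [:-a, 1:] * q" using insert.prems by (metis dvdE insertI1 poly_eq_0_iff_dvd)
  have "poly q x = 0" if "x \<in> R" for x
    using insert.prems[of x] insert.hyps that q by auto
  then have "(\<Prod>x\<in>R. [:-x, 1:]) dvd q" by (rule insert.IH)
  then show ?case using insert.hyps q
    by (simp only: prod.insert[OF insert.hyps] mult_dvd_mono dvd_refl)
qed simp

section \<open>Roots of an orthogonal polynomial and the quadrature at them\<close>

context
  fixes m n :: nat and lam b :: "nat \<Rightarrow> real" and p :: "real poly"
  assumes pd: "ip_posdef m lam b n" and p: "p \<noteq> 0" "degree p = n"
    and orth: "\<And>q. q \<in> polys_lt n \<Longrightarrow> poly_ip m lam b p q = 0"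
begin

text \<open>The cofactor \<open>q\<close> has degree below \<open>n\<close>, so orthogonality to it
  contradicts the positive weight \<open>g\<close>.\<close>

lemma orth_poly_no_pos_factor:
  assumes q: "p = g * q" and dg: "degree g > 0" and g: "\<And>x. poly g x > 0"
  shows False
proof -
  have "q \<noteq> 0" "g \<noteq> 0" using p q by auto
  then have "degree q < n" using p(2) dg unfolding q by (simp add: degree_mult_eq)
  then have qn: "q \<in> polys_lt n" by (simp add: polys_lt_iff)
  have "poly_ip m lam b (g * q) q > 0" by (rule weighted_ip_pos[OF pd qn \<open>q \<noteq> 0\<close> g])
  then show False using orth[OF qn] q by simp
qed

text \<open>Moving one of the two factors across the inner product with \<open>q\<close> gives the
  squared norm of \<open>(X - x) q\<close>, which is positive.\<close>

lemma orth_poly_no_double_root: "p \<noteq> [:-x, 1:] * ([:-x, 1:] * q)"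
proof
  assume q: "p = [:-x, 1:] * ([:-x, 1:] * q)"
  have f0: "[:-x, 1:] * q \<noteq> 0" using p q by fastforce
  have "p \<in> polys_lt (Suc n)" using p by (simp add: polys_lt_iff)
  then have f: "[:-x, 1:] * q \<in> polys_lt n" using polys_lt_linear_factor q by fastforce
  then have "q \<in> polys_lt n"
    by (meson polys_lt_linear_factor polys_lt_mono diff_le_self)
  then have "poly_ip m lam b p q = 0" by (rule orth)
  also have "poly_ip m lam b p q = poly_ip m lam b ([:-x, 1:] * q) ([:-x, 1:] * q)"
    unfolding q by (rule poly_ip_mult_left)
  finally show False using ip_posdef_pos[OF pd f f0] by simp
qed

text \<open>Once each distinct real root is split off, the cofactor \<open>g\<close> must be
  constant: a complex root of \<open>g\<close> would yield either a double real root of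
  \<open>p\<close> or a positive quadratic factor.\<close>

lemma orth_poly_card_roots: "card {x. poly p x = 0} = n"
proof -
  let ?R = "{x. poly p x = 0}"
  have fin: "finite ?R" by (rule poly_roots_finite[OF p(1)])
  have "(\<Prod>x\<in>?R. [:-x, 1:]) dvd p" using fin by (rule prod_linear_factors_dvd) simp
  then obtain g where g: "p = (\<Prod>x\<in>?R. [:-x, 1:]) * g" by (rule dvdE)
  have "g \<noteq> 0" using g p(1) by auto
  have "degree (\<Prod>x\<in>?R. [:-x, 1:]) = card ?R"
    by (subst degree_prod_eq_sum_degree) auto
  moreover have "(\<Prod>x\<in>?R. [:-x, 1:]) \<noteq> 0" using g p(1) by (metis mult_zero_left)
  ultimately have deg: "n = card ?R + degree g"
    using \<open>g \<noteq> 0\<close> p(2) g by (metis degree_mult_eq)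
  have "degree g = 0"
  proof (rule ccontr)
    assume "degree g \<noteq> 0"
    then have "\<not> constant (poly (map_poly complex_of_real g))"
      by (simp add: constant_degree)
    then obtain z where z: "poly (map_poly complex_of_real g) z = 0"
      using fundamental_theorem_of_algebra by blast
    show False
    proof (cases "Im z = 0")
      case True
      then have "z = of_real (Re z)" by (simp add: complex_eq_iff)
      then have gx: "poly g (Re z) = 0"
        using z by (metis of_real_hom.poly_map_poly of_real_eq_0_iff)
      obtain g' where g': "g = [:-Re z, 1:] * g'" using gx by (metis dvdE poly_eq_0_iff_dvd)
      \<comment> \<open>This root was already split off once, and \<open>g\<close> supplies the
        factor a second time.\<close>
      have "poly p (Re z) = 0" using gx by (subst g) simp
      then have "(\<Prod>x\<in>?R. [:-x, 1:]) = [:-Re z, 1:] * (\<Prod>x\<in>?R - {Re z}. [:-x, 1:])"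
        using fin by (intro prod.remove) auto
      then have "p = [:-Re z, 1:] * ([:-Re z, 1:] * ((\<Prod>x\<in>?R - {Re z}. [:-x, 1:]) * g'))"
        by (subst g) (simp only: g' mult_ac)
      then show False using orth_poly_no_double_root by blast
    next
      case False
      obtain g' where g': "g = [:(Re z)\<^sup>2 + (Im z)\<^sup>2, - 2 * Re z, 1:] * g'"
        using nonreal_root_quadratic_dvd[OF z False] by (rule dvdE)
      show False
      proof (rule orth_poly_no_pos_factor)
        show "p = [:(Re z)\<^sup>2 + (Im z)\<^sup>2, - 2 * Re z, 1:] * ((\<Prod>x\<in>?R. [:-x, 1:]) * g')"
          by (subst g) (simp only: g' mult_ac)
        show "poly [:(Re z)\<^sup>2 + (Im z)\<^sup>2, - 2 * Re z, 1:] x > 0" for x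
        proof -
          have "poly [:(Re z)\<^sup>2 + (Im z)\<^sup>2, - 2 * Re z, 1:] x = (x - Re z)\<^sup>2 + (Im z)\<^sup>2"
            by (simp add: power2_eq_square algebra_simps)
          also have "\<dots> > 0" using False by (simp add: add_nonneg_pos)
          finally show ?thesis .
        qed
      qed simp
    qed
  qed
  then show ?thesis using deg by simp
qed

text \<open>The polynomials \<open>p / (X - x)\<close>, \<open>x\<close> a root of \<open>p\<close>, diagonalize both the inner product and
  multiplication by \<open>X\<close>, with eigenvalues \<open>x\<close>.\<close>

lemma moment_pos:
  assumes pos: "\<And>x. x \<le> 0 \<Longrightarrow> poly p x \<noteq> 0" and q: "q \<in> polys_lt n" "q \<noteq> 0"
  shows "poly_ip m lam b ([:0, 1:] * q) q > 0"
proof -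
  define R where "R = {x. poly p x = 0}"
  have fin: "finite R" unfolding R_def by (rule poly_roots_finite[OF p(1)])
  have card: "card R = n" unfolding R_def by (rule orth_poly_card_roots)
  have "n > 0" using q by (auto simp: polys_lt_iff)
  \<comment> \<open>Up to scaling, the Lagrange basis polynomials for the roots of
    \<open>p\<close>.\<close>
  define l where "l x = p div [:-x, 1:]" for x
  have l: "p = [:-x, 1:] * l x" if "x \<in> R" for x
    using that unfolding l_def R_def by (metis dvd_mult_div_cancel mem_Collect_eq poly_eq_0_iff_dvd)
  have pS: "p \<in> polys_lt (Suc n)" using p by (simp add: polys_lt_iff)
  have ln: "l x \<in> polys_lt n" if "x \<in> R" for x
    using polys_lt_linear_factor[of "-x" "l x" "Suc n"] l[OF that] pS by simp
  have l0: "l x \<noteq> 0" if "x \<in> R" for x using l[OF that] p(1) by (metis mult_zero_right)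
  have lx: "poly (l x) x \<noteq> 0" if "x \<in> R" for x
    using orth_poly_no_double_root[of x] l[OF that] by (metis dvdE poly_eq_0_iff_dvd)
  have ly: "poly (l x) y = 0" if "x \<in> R" "y \<in> R" "x \<noteq> y" for x y
  proof -
    have "poly ([:-x, 1:] * l x) y = 0" using that(2) l[OF that(1)] by (simp add: R_def)
    then show ?thesis using that(3) by simp
  qed
  have lo: "poly_ip m lam b (l x) (l y) = 0" if xy: "x \<in> R" "y \<in> R" "x \<noteq> y" for x y
  proof -
    \<comment> \<open>Moved across, the factor \<open>X - y\<close> completes \<open>l y\<close> to
      \<open>p\<close>, which is orthogonal to \<open>h\<close>.\<close>
    obtain h where h: "l x = [:-y, 1:] * h" using ly[OF xy] by (metis dvdE poly_eq_0_iff_dvd)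
    have hn: "h \<in> polys_lt n"
      using polys_lt_linear_factor ln[OF xy(1)] h by (metis polys_lt_mono diff_le_self)
    have "poly_ip m lam b (l x) (l y) = poly_ip m lam b h p"
      unfolding h poly_ip_mult_left using l[OF xy(2)] by simp
    then show ?thesis using orth[OF hn] by (simp add: poly_ip_commute)
  qed
  have lX: "poly_ip m lam b ([:0, 1:] * l x) f = x * poly_ip m lam b (l x) f"
    if "x \<in> R" "f \<in> polys_lt n" for x f
  proof -
    \<comment> \<open>Modulo \<open>p\<close>, multiplication by \<open>X\<close> acts on
      \<open>l x\<close> as the scalar \<open>x\<close>.\<close>
    have "[:0, 1:] * l x = p + Polynomial.smult x (l x)"
      by (subst l[OF that(1)]) simp
    then show ?thesis using orth[OF that(2)] by (simp only: poly_ip_linear)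
  qed
  \<comment> \<open>Lagrange interpolation: \<open>q\<close> and \<open>q'\<close> have degree below
    \<open>n\<close> and agree at the \<open>n\<close> roots.\<close>
  define c where "c x = poly q x / poly (l x) x" for x
  define q' where "q' = (\<Sum>x\<in>R. Polynomial.smult (c x) (l x))"
  have "q' \<in> polys_lt n" unfolding q'_def using ln by auto
  have "q = q'"
  proof (rule poly_eqI_degree[of R])
    show "degree q < card R" "degree q' < card R"
      using q(1) \<open>q' \<in> polys_lt n\<close> card \<open>n > 0\<close> by (auto simp: polys_lt_iff)
    fix y assume y: "y \<in> R"
    have "poly q' y = (\<Sum>x\<in>R. if x = y then c y * poly (l y) y else 0)"
      unfolding q'_def poly_sum using ly y by (intro sum.cong) auto
    also have "\<dots> = c y * poly (l y) y" using fin y by simp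
    also have "\<dots> = poly q y" using lx[OF y] by (simp add: c_def)
    finally show "poly q y = poly q' y" ..
  qed
  have ipc: "poly_ip m lam b (l x) q = c x * poly_ip m lam b (l x) (l x)" if x: "x \<in> R" for x
  proof -
    have "poly_ip m lam b (l x) q = (\<Sum>y\<in>R. c y * poly_ip m lam b (l x) (l y))"
      by (simp add: \<open>q = q'\<close> q'_def poly_ip_sum poly_ip_linear)
    also have "\<dots> = (\<Sum>y\<in>R. if y = x then c x * poly_ip m lam b (l x) (l x) else 0)"
      using lo x by (intro sum.cong) auto
    finally show ?thesis using fin x by simp
  qed
  \<comment> \<open>Only the first \<open>q\<close> is expanded; \<open>ipc\<close> then supplies
    the second factor \<open>c x\<close>.\<close>
  have "poly_ip m lam b ([:0, 1:] * q) q = (\<Sum>x\<in>R. c x * poly_ip m lam b ([:0, 1:] * l x) q)"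
    by (subst (1) \<open>q = q'\<close>)
      (simp only: q'_def sum_distrib_left poly_ip_sum mult_smult_right poly_ip_linear)
  also have "\<dots> = (\<Sum>x\<in>R. x * ((c x)\<^sup>2 * poly_ip m lam b (l x) (l x)))"
    using q(1) by (intro sum.cong refl) (simp only: lX ipc, simp add: power2_eq_square)
  also have "\<dots> > 0"
  proof -
    have "\<exists>x\<in>R. c x \<noteq> 0"
    proof (rule ccontr)
      assume "\<not> (\<exists>x\<in>R. c x \<noteq> 0)"
      then have "q' = 0" unfolding q'_def by (intro sum.neutral) simp
      then show False using q(2) \<open>q = q'\<close> by simp
    qed
    then obtain x where x: "x \<in> R" "c x \<noteq> 0" by blast
    have Rpos: "y > 0" if "y \<in> R" for y using pos[of y] that by (force simp: R_def)
    show ?thesis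
    proof (rule sum_pos2[OF fin x(1)])
      show "0 < x * ((c x)\<^sup>2 * poly_ip m lam b (l x) (l x))"
        using Rpos[OF x(1)] x(2) ip_posdef_pos[OF pd ln[OF x(1)] l0[OF x(1)]] by simp
      show "0 \<le> y * ((c y)\<^sup>2 * poly_ip m lam b (l y) (l y))" if "y \<in> R" for y
        using Rpos[OF that] by (intro mult_nonneg_nonneg) (auto simp: less_imp_le)
    qed
  qed
  finally show ?thesis .
qed

end

subsection \<open>Krylov spaces as spaces of polynomials\<close>

text \<open>This is \<open>q\<close> of the diagonal matrix applied to the right-hand side, so
  Krylov spaces are images of \<open>polys_lt n\<close>.\<close>

definition poly_vec :: "nat \<Rightarrow> (nat \<Rightarrow> real) \<Rightarrow> (nat \<Rightarrow> real) \<Rightarrow> real poly \<Rightarrow> real vec" where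
  "poly_vec m lam b q = vec m (\<lambda>k. poly q (lam (k + 1)) * b (k + 1))"

lemma sum_index_shift: "(\<Sum>i=1..m. f i) = (\<Sum>k<m. f (k + 1))" for f :: "nat \<Rightarrow> real"
  by (rule sum.reindex_bij_witness[of _ "\<lambda>k. k + 1" "\<lambda>i. i - 1"]) auto

lemma mat_diag_pow: "mat_diag m f ^\<^sub>m k = mat_diag m (\<lambda>i. f i ^ k)" for f :: "nat \<Rightarrow> 'a :: comm_semiring_1"
  by (induction k) (simp_all add: mult.commute, simp add: mat_diag_def)

lemma mat_diag_mult_vec:
  fixes f :: "nat \<Rightarrow> 'a :: comm_semiring_1"
  assumes "v \<in> carrier_vec m"
  shows "mat_diag m f *\<^sub>v v = vec m (\<lambda>i. f i * v $ i)"
proof (rule eq_vecI)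
  fix i assume "i < dim_vec (vec m (\<lambda>i. f i * v $ i))"
  then have i: "i < m" by simp
  then have "(mat_diag m f *\<^sub>v v) $ i = (\<Sum>j<m. (if i = j then f j else 0) * v $ j)"
    using assms by (auto simp: mat_diag_def scalar_prod_def atLeast0LessThan intro!: sum.cong)
  also have "\<dots> = (\<Sum>j<m. if j = i then f i * v $ i else 0)" by (intro sum.cong) auto
  also have "\<dots> = f i * v $ i" using i by simp
  finally show "(mat_diag m f *\<^sub>v v) $ i = vec m (\<lambda>i. f i * v $ i) $ i" using i by simp
qed (simp add: mat_diag_def)

lemma krylov_generator_eq:
  "(eig_mat m lam ^\<^sub>m k) *\<^sub>v rhs_vec m b = poly_vec m lam b (monom 1 k)"
  unfolding eig_mat_def mat_diag_pow
  by (subst mat_diag_mult_vec) (auto simp: rhs_vec_def poly_vec_def poly_monom)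

lemma poly_vec_eq_0_iff: "poly_vec m lam b q = 0\<^sub>v m \<longleftrightarrow> poly_ip m lam b q q = 0"
proof -
  have "poly_ip m lam b q q = 0 \<longleftrightarrow> (\<forall>k<m. (b (k + 1) * poly q (lam (k + 1)))\<^sup>2 = 0)"
    unfolding poly_ip_self sum_index_shift by (subst sum_nonneg_eq_0_iff) auto
  then show ?thesis by (auto simp: poly_vec_def vec_eq_iff)
qed

lemma poly_vec_diff: "poly_vec m lam b p = poly_vec m lam b q \<Longrightarrow> poly_vec m lam b (p - q) = 0\<^sub>v m"
  by (auto simp: poly_vec_def vec_eq_iff algebra_simps)

text \<open>As a list, the generators become matrix columns, and coinciding generators are not
  merged.\<close>

definition krylov_list :: "nat \<Rightarrow> (nat \<Rightarrow> real) \<Rightarrow> (nat \<Rightarrow> real) \<Rightarrow> nat \<Rightarrow> real vec list" where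
  "krylov_list m lam b n = map (\<lambda>k. poly_vec m lam b (monom 1 k)) [0..<n]"

lemma krylov_list_carrier: "set (krylov_list m lam b n) \<subseteq> carrier_vec m"
  by (auto simp: krylov_list_def poly_vec_def)

lemma krylov_eq_span:
  "krylov (eig_mat m lam) (rhs_vec m b) n =
     LinearCombinations.module.span class_ring (module_vec TYPE(real) m)
       (set (krylov_list m lam b n))"
proof -
  have "{(eig_mat m lam ^\<^sub>m k) *\<^sub>v rhs_vec m b | k. k < n} = set (krylov_list m lam b n)"
    unfolding krylov_generator_eq by (auto simp: krylov_list_def)
  moreover have "dim_vec (rhs_vec m b) = m" by (simp add: rhs_vec_def)
  ultimately show ?thesis unfolding krylov_def by simp
qed

lemma sum_monom_polys_lt: "(\<Sum>k<n. monom (u k) k) \<in> polys_lt n"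
  by (rule polys_lt_sum) (auto simp: polys_lt_def)

lemma coeff_sum_monom: "k < n \<Longrightarrow> coeff (\<Sum>k<n. monom (u k) k) k = u k"
  by (simp add: coeff_sum)

lemma krylov_list_mult_vec:
  "mat_of_cols m (krylov_list m lam b n) *\<^sub>v vec n u =
     poly_vec m lam b (\<Sum>k<n. monom (u k) k)"
  by (rule eq_vecI)
    (auto simp: krylov_list_def mat_of_cols_def poly_vec_def scalar_prod_def poly_sum poly_monom
      sum_distrib_left sum_distrib_right atLeast0LessThan mult_ac intro!: sum.cong)

text \<open>The dimension is the rank of the matrix with the generators as columns. A vector in its
  null space is the coefficient vector of a polynomial of zero seminorm.\<close>

lemma krylov_dim_eq_iff:
  "krylov_dim (eig_mat m lam) (rhs_vec m b) n = n \<longleftrightarrow> ip_posdef m lam b n"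
proof -
  interpret vec_space "TYPE(real)" m .
  let ?L = "krylov_list m lam b n"
  let ?M = "mat_of_cols m ?L"
  have len: "length ?L = n" by (simp add: krylov_list_def)
  have cols: "cols ?M = ?L" by (rule cols_mat_of_cols[OF krylov_list_carrier])
  have M: "?M \<in> carrier_mat m n" using len by auto
  have dim: "krylov_dim (eig_mat m lam) (rhs_vec m b) n = rank ?M"
    unfolding krylov_dim_def rank_def krylov_eq_span cols by (simp add: rhs_vec_def)
  show ?thesis
  proof
    assume "krylov_dim (eig_mat m lam) (rhs_vec m b) n = n"
    then have rk: "rank ?M = n" by (simp add: dim)
    \<comment> \<open>Independence concerns the set of columns, so a repetition has to be excluded
      first: it would leave fewer than \<open>n\<close> vectors to choose from.\<close>
    have dist: "distinct (cols ?M)"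
    proof (rule ccontr)
      assume nd: "\<not> distinct (cols ?M)"
      obtain S where S: "maximal S (\<lambda>T. T \<subseteq> set (cols ?M) \<and> lin_indpt T)"
        using maximal_exists_superset[of "set (cols ?M)" "\<lambda>T. T \<subseteq> set (cols ?M) \<and> lin_indpt T" "{}"]
        by (auto simp: lin_dep_def)
      have "rank ?M = card S" by (rule rank_card_indpt[OF M S])
      also have "\<dots> \<le> card (set (cols ?M))" using S by (auto simp: maximal_def intro!: card_mono)
      also have "\<dots> < n" using nd card_length[of ?L] len card_distinct[of ?L]
        unfolding cols by (metis le_neq_implies_less)
      finally show False using rk by simp
    qed
    have li: "lin_indpt (set (cols ?M))" by (rule full_rank_lin_indpt[OF M rk dist])
    show "ip_posdef m lam b n"
      unfolding ip_posdef_def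
    proof (intro ballI impI, rule ccontr)
      fix q assume q: "q \<in> polys_lt n" "poly_ip m lam b q q = 0" "q \<noteq> 0"
      have qs: "q = (\<Sum>k<n. monom (coeff q k) k)"
        using q(1) by (intro poly_eqI) (auto simp: coeff_sum polys_lt_def)
      have "?M *\<^sub>v vec n (coeff q) = 0\<^sub>v m"
        unfolding krylov_list_mult_vec using qs poly_vec_eq_0_iff q(2) by metis
      moreover have "vec n (coeff q) \<noteq> 0\<^sub>v n"
      proof
        assume "vec n (coeff q) = 0\<^sub>v n"
        then have "coeff q k = 0" if "k < n" for k using that by (auto simp: vec_eq_iff)
        then show False using q(1,3) by (metis leading_coeff_0_iff polys_lt_iff)
      qed
      ultimately show False using lin_depI[OF M vec_carrier _ _ dist] li by blast
    qed
  next
    assume pd: "ip_posdef m lam b n"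
    have z: "q = 0" if "q \<in> polys_lt n" "poly_vec m lam b q = 0\<^sub>v m" for q
      using pd that unfolding ip_posdef_def poly_vec_eq_0_iff by blast
    have dist: "distinct (cols ?M)"
    proof -
      have "i = j" if ij: "i < n" "j < n"
        "poly_vec m lam b (monom 1 i) = poly_vec m lam b (monom 1 j)" for i j
      proof -
        have "monom 1 i - monom 1 j = (0 :: real poly)"
          by (rule z) (use ij poly_vec_diff in \<open>auto simp: polys_lt_def\<close>)
        then have "coeff (monom 1 i) i = coeff (monom (1 :: real) j) i" by simp
        then show "i = j" by (auto split: if_splits)
      qed
      then show ?thesis by (subst cols) (auto simp: krylov_list_def distinct_map inj_on_def)
    qed
    have "lin_indpt (set (cols ?M))"
    proof
      assume "lin_dep (set (cols ?M))"
      then obtain v where v: "v \<in> carrier_vec n" "v \<noteq> 0\<^sub>v n" "?M *\<^sub>v v = 0\<^sub>v m"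
        using lin_depE[OF M _ dist] by blast
      have vv: "v = vec n (($) v)" using v(1) by (auto simp: vec_eq_iff)
      have "(\<Sum>k<n. monom (v $ k) k) = 0"
        by (rule z[OF sum_monom_polys_lt])
          (use v(3) vv krylov_list_mult_vec[of m lam b n "($) v"] in simp)
      then have "v $ k = 0" if "k < n" for k
        using coeff_sum_monom[OF that, of "($) v"] by simp
      then show False using v(1,2) by (auto simp: vec_eq_iff)
    qed
    then have "rank ?M = n" by (rule lin_indpt_full_rank[OF M dist])
    then show "krylov_dim (eig_mat m lam) (rhs_vec m b) n = n" by (simp add: dim)
  qed
qed

text \<open>The node polynomial, of degree \<open>m\<close>, has zero seminorm. This bound makes the
  \<open>GREATEST\<close> in \<open>grade\<close> meaningful.\<close>

lemma ip_posdef_le_dim: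
  assumes "ip_posdef m lam b n"
  shows "n \<le> m"
proof (rule ccontr)
  assume "\<not> n \<le> m"
  let ?q = "\<Prod>i=1..m. [:- lam i, 1:]"
  have "degree ?q = m" by (subst degree_prod_eq_sum_degree) auto
  then have "?q \<in> polys_lt n" using \<open>\<not> n \<le> m\<close> by (simp add: polys_lt_iff)
  moreover have "?q \<noteq> 0" by (subst prod_zero_iff) auto
  moreover have "poly_ip m lam b ?q ?q = 0"
    unfolding poly_ip_self by (intro sum.neutral) (auto simp: poly_prod)
  ultimately show False using assms unfolding ip_posdef_def by blast
qed

text \<open>The admissible \<open>n\<close> include 0, are bounded by \<open>m\<close> and are
  closed downwards.\<close>

lemma le_grade_iff: "n \<le> grade (eig_mat m lam) (rhs_vec m b) \<longleftrightarrow> ip_posdef m lam b n"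
proof -
  have "grade (eig_mat m lam) (rhs_vec m b) = (GREATEST n. ip_posdef m lam b n)"
    unfolding grade_def krylov_dim_eq_iff ..
  moreover have "ip_posdef m lam b 0" by (auto simp: ip_posdef_def polys_lt_iff)
  ultimately show ?thesis
    by (metis GreatestI_nat Greatest_le_nat ip_posdef_le_dim ip_posdef_mono)
qed

lemma krylov_obtain_poly:
  assumes "v \<in> krylov (eig_mat m lam) (rhs_vec m b) n"
  obtains q where "q \<in> polys_lt n" "v = poly_vec m lam b q"
proof -
  interpret vec_space "TYPE(real)" m .
  let ?L = "krylov_list m lam b n"
  have "v \<in> span_list ?L"
    using assms unfolding krylov_eq_span span_list_as_span[OF krylov_list_carrier] .
  then obtain c where "v = lincomb_list c ?L" by (rule in_span_listE)
  also have "\<dots> = mat_of_cols m ?L *\<^sub>v vec (length ?L) c"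
    by (rule lincomb_list_as_mat_mult) (use krylov_list_carrier[of m lam b n] carrier_vecD in blast)
  also have "length ?L = n" by (simp add: krylov_list_def)
  finally show ?thesis using that sum_monom_polys_lt krylov_list_mult_vec by metis
qed

text \<open>Translates the definiteness required by CG into positivity of multiplication by
  \<open>X\<close>.\<close>

lemma poly_vec_quadratic_form:
  "poly_vec m lam b q \<bullet> (eig_mat m lam *\<^sub>v poly_vec m lam b q) = poly_ip m lam b ([:0, 1:] * q) q"
proof -
  have "eig_mat m lam *\<^sub>v poly_vec m lam b q
      = vec m (\<lambda>k. lam (k + 1) * (poly q (lam (k + 1)) * b (k + 1)))"
    unfolding eig_mat_def by (subst mat_diag_mult_vec) (auto simp: poly_vec_def)
  then show ?thesis
    unfolding poly_ip_weighted sum_index_shift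
    by (auto simp: scalar_prod_def poly_vec_def atLeast0LessThan power2_eq_square mult_ac
        intro!: sum.cong)
qed

lemma cg_well_definedI:
  assumes "ip_posdef m lam b n"
    and "\<And>q. q \<in> polys_lt n \<Longrightarrow> q \<noteq> 0 \<Longrightarrow> poly_ip m lam b ([:0, 1:] * q) q > 0"
  shows "cg_well_defined (eig_mat m lam) (rhs_vec m b) n"
  unfolding cg_well_defined_def
proof (intro conjI ballI impI)
  show "n \<le> grade (eig_mat m lam) (rhs_vec m b)" using assms(1) by (simp add: le_grade_iff)
  fix v assume v: "v \<in> krylov (eig_mat m lam) (rhs_vec m b) n" "v \<noteq> 0\<^sub>v (dim_vec (rhs_vec m b))"
  obtain q where q: "q \<in> polys_lt n" "v = poly_vec m lam b q" using krylov_obtain_poly[OF v(1)] .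
  have "q \<noteq> 0"
    using v(2) q(2) poly_vec_eq_0_iff[of m lam b 0] by (auto simp: rhs_vec_def poly_ip_linear)
  then show "v \<bullet> (eig_mat m lam *\<^sub>v v) > 0"
    unfolding q(2) poly_vec_quadratic_form by (rule assms(2)[OF q(1)])
qed

subsection \<open>The linear system for \<open>\<sigma>\<close>\<close>

lemma sum_tail_shift: "(\<Sum>j=d+1..dt. f j) = (\<Sum>k<dt - d. f (d + 1 + k))"
  for f :: "nat \<Rightarrow> 'a :: comm_monoid_add"
  by (rule sum.reindex_bij_witness[of _ "\<lambda>k. d + 1 + k" "\<lambda>j. j - (d + 1)"]) auto

lemma poly_ip_split:
  assumes "d \<le> dt"
  shows "poly_ip dt lam b p q =
    poly_ip d lam b p q + (\<Sum>j=d+1..dt. (b j)\<^sup>2 * poly p (lam j) * poly q (lam j))"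
proof -
  have "{1..dt} = {1..d} \<union> {d+1..dt}" using assms by auto
  then show ?thesis unfolding poly_ip_def by (simp add: sum.union_disjoint)
qed

text \<open>Additional nodes only add nonnegative terms to the squared seminorm.\<close>

lemma ip_posdef_extend:
  assumes "ip_posdef d lam b n" "d \<le> dt"
  shows "ip_posdef dt lam b n"
  unfolding ip_posdef_def
proof (intro ballI impI)
  fix q assume q: "q \<in> polys_lt n" "poly_ip dt lam b q q = 0"
  have "(\<Sum>j=d+1..dt. (b j)\<^sup>2 * poly q (lam j) * poly q (lam j)) \<ge> 0"
    by (intro sum_nonneg) (simp add: mult.assoc)
  then have "poly_ip d lam b q q \<le> 0"
    using q(2) unfolding poly_ip_split[OF assms(2)] by linarith
  then have "poly_ip d lam b q q = 0" by (rule antisym) simp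
  then show "q = 0" using assms(1) q(1) by (auto simp: ip_posdef_def)
qed

section \<open>The system matrix, its solution and the resulting polynomial\<close>

context
  fixes d dt n :: nat and lam b :: "nat \<Rightarrow> real" and K :: "nat \<Rightarrow> real poly"
  assumes n: "n \<ge> 1" and pd: "ip_posdef d lam b n"
    and K: "\<And>j. is_kernel d lam b n (lam j) (K j)"
    and nodes: "\<forall>i\<in>{1..d}. lam d \<le> lam i" and lam_d: "lam d > 0"
    and tail: "\<And>j. j \<in> {d+1..dt} \<Longrightarrow> lam j < lam d"
begin

lemma kernel_0_pos: "j \<in> {d+1..dt} \<Longrightarrow> poly (K j) 0 > 0"
  by (rule kernel_pos_below[OF pd n K nodes tail lam_d])

lemma xi_eq: "xi_poly d lam b (n - 1) j = Polynomial.smult (1 / poly (K j) 0) (K j)"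
  by (rule xi_poly_eq_kernel[OF pd n K])

lemma poly_ip_xi:
  "q \<in> polys_lt n \<Longrightarrow>
    poly_ip d lam b (xi_poly d lam b (n - 1) j) q = poly q (lam j) / poly (K j) 0"
  unfolding xi_eq using is_kernelD(2)[OF K] by (simp add: poly_ip_linear)

lemma xi_polys_lt: "xi_poly d lam b (n - 1) j \<in> polys_lt n"
  unfolding xi_eq using is_kernelD(1)[OF K] by blast

text \<open>By reproduction the numerator is \<open>poly (K j) (lam j) / (poly (K j) 0)^2\<close>,
  and the value at \<open>lam j\<close> cancels.\<close>

lemma D_entry:
  assumes "j \<in> {d+1..dt}"
  shows "(poly_seminorm d lam b (xi_poly d lam b (n - 1) j))\<^sup>2
    / poly (xi_poly d lam b (n - 1) j) (lam j) = 1 / poly (K j) 0"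
  using kernel_diag_pos[OF pd n K, of j] kernel_0_pos[OF assms]
  unfolding poly_seminorm_sq poly_ip_xi[OF xi_polys_lt] unfolding xi_eq by simp

abbreviation (input) "system_mat \<equiv> D_mat d dt lam b n + (B_mat d dt b ^\<^sub>m 2) * C_mat d dt lam b n"

abbreviation (input) "xi_comb x \<equiv>
  \<Sum>k<dt - d. Polynomial.smult (x k) (xi_poly d lam b (n - 1) (d + 1 + k))"

lemma B_mat_sq: "B_mat d dt b ^\<^sub>m 2 = mat_diag (dt - d) (\<lambda>k. (b (d + 1 + k))\<^sup>2)"
  unfolding B_mat_def mat_diag_pow ..

lemma system_mat_carrier: "system_mat \<in> carrier_mat (dt - d) (dt - d)"
  unfolding B_mat_sq by (auto simp: D_mat_def C_mat_def mat_diag_def)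

text \<open>\<open>C_mat\<close> applied to \<open>x\<close> lists the values of
  \<open>xi_comb\<close> at the tail nodes, which turns the system into statements about one
  polynomial.\<close>

lemma system_mat_mult_vec:
  assumes x: "x \<in> carrier_vec (dt - d)" and k: "k < dt - d"
  shows "(system_mat *\<^sub>v x) $ k = x $ k / poly (K (d + 1 + k)) 0
    + (b (d + 1 + k))\<^sup>2 * poly (xi_comb (($) x)) (lam (d + 1 + k))"
proof -
  let ?C = "C_mat d dt lam b n"
  have C: "?C \<in> carrier_mat (dt - d) (dt - d)" by (simp add: C_mat_def)
  have D: "D_mat d dt lam b n \<in> carrier_mat (dt - d) (dt - d)" by (simp add: D_mat_def)
  have B: "B_mat d dt b ^\<^sub>m 2 \<in> carrier_mat (dt - d) (dt - d)" unfolding B_mat_sq by simp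
  have Cx: "?C *\<^sub>v x \<in> carrier_vec (dt - d)" using C x by simp
  have "system_mat *\<^sub>v x = D_mat d dt lam b n *\<^sub>v x + (B_mat d dt b ^\<^sub>m 2) *\<^sub>v (?C *\<^sub>v x)"
    using B C D x by (simp add: add_mult_distrib_mat_vec[of _ "dt - d" "dt - d"]
      assoc_mult_mat_vec[of _ "dt - d" "dt - d" _ "dt - d"])
  moreover have "(D_mat d dt lam b n *\<^sub>v x) $ k = x $ k / poly (K (d + 1 + k)) 0"
    unfolding D_mat_def mat_diag_mult_vec[OF x]
    by (subst index_vec[OF k], subst D_entry) (use k in auto)
  moreover have "((B_mat d dt b ^\<^sub>m 2) *\<^sub>v (?C *\<^sub>v x)) $ k
      = (b (d + 1 + k))\<^sup>2 * (?C *\<^sub>v x) $ k"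
    using k unfolding B_mat_sq mat_diag_mult_vec[OF Cx] by simp
  moreover have "(?C *\<^sub>v x) $ k = poly (xi_comb (($) x)) (lam (d + 1 + k))"
    using k x by (auto simp: C_mat_def scalar_prod_def poly_sum atLeast0LessThan mult.commute
        intro!: sum.cong)
  moreover have "dim_vec ((B_mat d dt b ^\<^sub>m 2) *\<^sub>v (?C *\<^sub>v x)) = dt - d"
    by (simp only: dim_mult_mat_vec carrier_matD(1)[OF B])
  ultimately show ?thesis using k by simp
qed

text \<open>For \<open>x\<close> in the null space, reproduction and the row equations express the
  squared norm of \<open>?g\<close> as minus a sum of squares, so \<open>?g = 0\<close>.\<close>

lemma system_mat_injective:
  assumes x: "x \<in> carrier_vec (dt - d)" and z: "system_mat *\<^sub>v x = 0\<^sub>v (dt - d)"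
  shows "x = 0\<^sub>v (dt - d)"
proof -
  let ?g = "xi_comb (($) x)"
  have g: "?g \<in> polys_lt n" using xi_polys_lt by blast
  have eq: "x $ k / poly (K (d + 1 + k)) 0 = - ((b (d + 1 + k))\<^sup>2 * poly ?g (lam (d + 1 + k)))"
    if k: "k < dt - d" for k
    using system_mat_mult_vec[OF x k] k unfolding z by simp
  have "poly_ip d lam b ?g ?g
      = (\<Sum>k<dt - d. x $ k / poly (K (d + 1 + k)) 0 * poly ?g (lam (d + 1 + k)))"
    unfolding poly_ip_sum(1) poly_ip_linear(3) poly_ip_xi[OF g] by simp
  also have "\<dots> = (\<Sum>k<dt - d. - (b (d + 1 + k) * poly ?g (lam (d + 1 + k)))\<^sup>2)"
    by (intro sum.cong refl) (simp only: eq lessThan_iff, simp add: power2_eq_square)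
  also have "\<dots> \<le> 0" by (intro sum_nonpos) simp
  finally have "?g = 0" using ip_posdef_pos[OF pd g] by linarith
  \<comment> \<open>The \<xi> may be linearly dependent, so the row equations are used once
    more.\<close>
  have "x $ k = 0" if k: "k < dt - d" for k
  proof -
    have "d + 1 + k \<in> {d+1..dt}" using k by simp
    then have "poly (K (d + 1 + k)) 0 > 0" by (rule kernel_0_pos)
    then show ?thesis using eq[OF k] unfolding \<open>?g = 0\<close> by simp
  qed
  then show ?thesis using x by (auto simp: vec_eq_iff)
qed

text \<open>Injectivity gives a nonzero determinant, so \<open>mat_inverse\<close> returns a genuine
  inverse.\<close>

lemma sigma_vec_solves:
  shows "sigma_vec d dt lam b n \<in> carrier_vec (dt - d)"
    and "k < dt - d \<Longrightarrow> (system_mat *\<^sub>v sigma_vec d dt lam b n) $ k =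
      (b (d + 1 + k))\<^sup>2 * poly (varsigma_poly d lam b n) (lam (d + 1 + k))"
proof -
  let ?M = "D_mat d dt lam b n + (B_mat d dt b ^\<^sub>m 2) * C_mat d dt lam b n"
  let ?u = "(B_mat d dt b ^\<^sub>m 2) *\<^sub>v w_vec d dt lam b n"
  have w: "w_vec d dt lam b n \<in> carrier_vec (dt - d)" by (simp add: w_vec_def)
  have u: "?u = vec (dt - d)
      (\<lambda>k. (b (d + 1 + k))\<^sup>2 * poly (varsigma_poly d lam b n) (lam (d + 1 + k)))"
    unfolding B_mat_sq mat_diag_mult_vec[OF w] by (auto simp: w_vec_def)
  have "det ?M \<noteq> 0"
    unfolding det_0_iff_vec_prod_zero_field[OF system_mat_carrier]
    using system_mat_injective by blast
  then have "?M \<in> Units (ring_mat TYPE(real) (dt - d) ())"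
    by (rule det_non_zero_imp_unit[OF system_mat_carrier])
  then obtain Mi where Mi: "mat_inverse ?M = Some Mi"
    using mat_inverse(1)[OF system_mat_carrier, of "()"] by (cases "mat_inverse ?M") auto
  have inv: "?M * Mi = 1\<^sub>m (dt - d)" "Mi \<in> carrier_mat (dt - d) (dt - d)"
    using mat_inverse(2)[OF system_mat_carrier Mi] by auto
  have s: "sigma_vec d dt lam b n = Mi *\<^sub>v ?u" by (simp add: sigma_vec_def Mi)
  have uc: "?u \<in> carrier_vec (dt - d)" unfolding u by simp
  show "sigma_vec d dt lam b n \<in> carrier_vec (dt - d)" unfolding s using inv(2) uc by simp
  have "?M *\<^sub>v sigma_vec d dt lam b n = ?M * Mi *\<^sub>v ?u"
    unfolding s by (rule assoc_mult_mat_vec[OF system_mat_carrier inv(2) uc, symmetric])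
  also have "\<dots> = ?u" unfolding inv(1) using uc by simp
  finally have "?M *\<^sub>v sigma_vec d dt lam b n = ?u" .
  then show "(?M *\<^sub>v sigma_vec d dt lam b n) $ k =
      (b (d + 1 + k))\<^sup>2 * poly (varsigma_poly d lam b n) (lam (d + 1 + k))" if "k < dt - d"
    using that by (simp only: u index_vec)
qed

abbreviation (input) "sig j \<equiv> sigma_vec d dt lam b n $ (j - (d + 1))"

definition "tilde_poly = varsigma_poly d lam b n -
  (\<Sum>j=d+1..dt. Polynomial.smult (sig j) (xi_poly d lam b (n - 1) j))"

text \<open>A row of the linear system with the \<open>C_mat\<close> term moved to the side of
  \<varsigma>.\<close>

lemma tilde_poly_tail:
  assumes j: "j \<in> {d+1..dt}"
  shows "(b j)\<^sup>2 * poly tilde_poly (lam j) = sig j / poly (K j) 0"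
proof -
  define k where "k = j - (d + 1)"
  have k: "k < dt - d" "j = d + 1 + k" using j by (auto simp: k_def)
  have "poly tilde_poly (lam j) = poly (varsigma_poly d lam b n) (lam j)
      - poly (xi_comb (($) (sigma_vec d dt lam b n))) (lam j)"
    unfolding tilde_poly_def sum_tail_shift by simp
  then have "(b j)\<^sup>2 * poly tilde_poly (lam j) = (b j)\<^sup>2 * poly (varsigma_poly d lam b n) (lam j)
      - (b j)\<^sup>2 * poly (xi_comb (($) (sigma_vec d dt lam b n))) (lam j)"
    by (simp only: right_diff_distrib)
  moreover have "sig j / poly (K j) 0 = sigma_vec d dt lam b n $ k / poly (K j) 0"
    by (simp add: k_def)
  ultimately show ?thesis
    using sigma_vec_solves(2)[OF k(1)] system_mat_mult_vec[OF sigma_vec_solves(1) k(1)]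
    unfolding k(2) by linarith
qed

text \<open>\<varsigma> is orthogonal to \<open>q\<close>, so the first \<open>d\<close> nodes leave
  only the reproduced values of \<open>q\<close> at the tail nodes; \<open>tilde_poly_tail\<close>
  makes the tail nodes contribute the opposite sum.\<close>

lemma tilde_poly_orth:
  assumes "d \<le> dt" and q: "q \<in> polys_lt n"
  shows "poly_ip dt lam b tilde_poly q = 0"
proof -
  have "poly_ip d lam b tilde_poly q = - (\<Sum>j=d+1..dt. sig j * (poly q (lam j) / poly (K j) 0))"
    unfolding tilde_poly_def poly_ip_linear poly_ip_sum poly_ip_xi[OF q]
    using varsigma_poly_props(4)[OF pd nodes lam_d q] by simp
  moreover have "(\<Sum>j=d+1..dt. (b j)\<^sup>2 * poly tilde_poly (lam j) * poly q (lam j))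
      = (\<Sum>j=d+1..dt. sig j * (poly q (lam j) / poly (K j) 0))"
    by (intro sum.cong refl) (simp only: tilde_poly_tail, simp)
  ultimately show ?thesis unfolding poly_ip_split[OF assms(1)] by simp
qed

lemma tilde_poly_degree: "degree tilde_poly \<le> n" "coeff tilde_poly n \<noteq> 0"
proof -
  let ?S = "\<Sum>j=d+1..dt. Polynomial.smult (sig j) (xi_poly d lam b (n - 1) j)"
  have S: "?S \<in> polys_lt n" using xi_polys_lt by blast
  then have "degree ?S \<le> n" using n by (auto simp: polys_lt_iff)
  then show "degree tilde_poly \<le> n"
    unfolding tilde_poly_def using varsigma_poly_props(1)[OF pd nodes lam_d]
    by (intro degree_diff_le)
  have "coeff ?S n = 0" using S by (simp add: polys_lt_def)
  then show "coeff tilde_poly n \<noteq> 0"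
    unfolding tilde_poly_def using varsigma_poly_props(2)[OF pd nodes lam_d] by simp
qed

lemma poly_tilde_0: "poly tilde_poly 0 = 1 - (\<Sum>j=d+1..dt. sig j)"
proof -
  have "poly (xi_poly d lam b (n - 1) j) 0 = 1" if "j \<in> {d+1..dt}" for j
    using kernel_0_pos[OF that] unfolding xi_eq by simp
  then show ?thesis
    unfolding tilde_poly_def
    by (simp add: poly_sum varsigma_poly_props(3)[OF pd nodes lam_d])
qed

text \<open>On the nonpositive axis every \<open>\<xi>\<close> is positive and at most \<open>\<varsigma>\<close>, so the condition on
  the norm of \<open>\<sigma>\<close> keeps the combination positive.\<close>

lemma tilde_poly_pos:
  assumes norm: "vec_norm1 (sigma_vec d dt lam b n) < 1" and x: "x \<le> 0"
  shows "poly tilde_poly x > 0"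
proof -
  let ?v = "poly (varsigma_poly d lam b n) x"
  have v: "?v > 0" using varsigma_poly_pos_below[OF pd nodes lam_d] x lam_d by simp
  \<comment> \<open>The absolute value admits entries of \<sigma> of either sign.\<close>
  have "sig j * poly (xi_poly d lam b (n - 1) j) x \<le> \<bar>sig j\<bar> * ?v" if j: "j \<in> {d+1..dt}" for j
  proof -
    have "poly (xi_poly d lam b (n - 1) j) x \<ge> 0"
      using kernel_pos_below[OF pd n K nodes tail[OF j], of x] kernel_0_pos[OF j] x lam_d
      unfolding xi_eq by simp
    moreover have "poly (xi_poly d lam b (n - 1) j) x \<le> ?v"
      using xi_le_varsigma[OF pd n K nodes lam_d tail[OF j] x] unfolding xi_eq by simp
    ultimately show ?thesis by (intro mult_mono) auto
  qed
  then have "(\<Sum>j=d+1..dt. sig j * poly (xi_poly d lam b (n - 1) j) x)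
      \<le> (\<Sum>j=d+1..dt. \<bar>sig j\<bar> * ?v)"
    by (rule sum_mono)
  also have "\<dots> = vec_norm1 (sigma_vec d dt lam b n) * ?v"
    unfolding vec_norm1_def sum_tail_shift
    using carrier_vecD[OF sigma_vec_solves(1)] by (simp add: sum_distrib_right)
  also have "\<dots> < ?v" using norm v by simp
  finally show ?thesis unfolding tilde_poly_def by (simp add: poly_sum)
qed

end

section \<open>Definiteness and the minimizer in the larger dimension\<close>

theorem theorem3p6:
  fixes d dt n :: nat and lam b :: "nat \<Rightarrow> real"
    and sig :: "nat \<Rightarrow> real" and s :: real
  assumes "1 \<le> d" and "d \<le> dt"
    and "\<forall>i j. 1 \<le> i \<and> i \<le> j \<and> j \<le> dt \<longrightarrow> lam j \<le> lam i"
    and "lam d > 0"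
    and "d < dt \<longrightarrow> lam d > lam (d + 1)"
    and "n \<in> {1..grade (eig_mat d lam) (rhs_vec d b)}"
    and "vec_norm1 (sigma_vec d dt lam b n) < 1"
  defines "sig \<equiv> \<lambda>j. sigma_vec d dt lam b n $ (j - (d + 1))"
  defines "s \<equiv> (\<Sum>j=d+1..dt. sig j)"
  shows "cg_well_defined (eig_mat dt lam) (rhs_vec dt b) n \<and>
    varsigma_poly dt lam b n =
      Polynomial.smult (1 / (1 - s))
        (varsigma_poly d lam b n -
         (\<Sum>j=d+1..dt. Polynomial.smult (sig j) (xi_poly d lam b (n - 1) j)))"
proof -
  have n: "n \<ge> 1" using assms(6) by simp
  have pd: "ip_posdef d lam b n" using assms(6) by (simp add: le_grade_iff)
  have "\<forall>j. \<exists>K. is_kernel d lam b n (lam j) K" using ex_kernel[OF pd] by blast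
  then obtain K where K: "\<And>j. is_kernel d lam b n (lam j) (K j)" by metis
  have nodes: "\<forall>i\<in>{1..d}. lam d \<le> lam i" using assms(2,3) by simp
  have tail: "lam j < lam d" if "j \<in> {d+1..dt}" for j
  proof -
    have "lam j \<le> lam (d + 1)" using assms(3) that by simp
    also have "\<dots> < lam d" using assms(5) that by simp
    finally show ?thesis .
  qed
  note ctxt = n pd K nodes assms(4) tail
  define p where "p = tilde_poly d dt n lam b"
  have p_eq: "p = varsigma_poly d lam b n -
      (\<Sum>j=d+1..dt. Polynomial.smult (sig j) (xi_poly d lam b (n - 1) j))"
    unfolding p_def sig_def by (rule tilde_poly_def[OF ctxt])
  have orth: "poly_ip dt lam b p q = 0" if "q \<in> polys_lt n" for q
    unfolding p_def by (rule tilde_poly_orth[OF ctxt assms(2) that])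
  have deg: "degree p \<le> n" unfolding p_def by (rule tilde_poly_degree(1)[OF ctxt])
  have lc: "coeff p n \<noteq> 0" unfolding p_def by (rule tilde_poly_degree(2)[OF ctxt])
  have p0: "poly p 0 = 1 - s"
    unfolding p_def s_def sig_def by (rule poly_tilde_0[OF ctxt])
  have pos: "poly p x > 0" if "x \<le> 0" for x
    unfolding p_def by (rule tilde_poly_pos[OF ctxt assms(7) that])
  have pdt: "ip_posdef dt lam b n" by (rule ip_posdef_extend[OF pd assms(2)])
  have "degree p = n" using deg le_degree[OF lc] by simp
  moreover have "p \<noteq> 0" using lc by auto
  \<comment> \<open>Positivity of \<open>p\<close> on the nonpositive axis leaves only positive
    roots, as \<open>moment_pos\<close> requires.\<close>
  ultimately have cg: "cg_well_defined (eig_mat dt lam) (rhs_vec dt b) n"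
    by (intro cg_well_definedI[OF pdt] moment_pos[OF pdt _ _ orth])
      (use pos in \<open>auto simp: less_le\<close>)
  \<comment> \<open>Orthogonality and degree identify \<open>p\<close>, made monic, with the
    minimizer; normalizing at 0 then cancels the leading coefficient.\<close>
  have "pi_poly dt lam b n = Polynomial.smult (1 / coeff p n) p"
    by (rule pi_poly_eqI[OF pdt]) (use deg lc orth in \<open>auto simp: poly_ip_linear\<close>)
  then have "varsigma_poly dt lam b n = Polynomial.smult (1 / (1 - s)) p"
    unfolding varsigma_poly_def using lc p0 by simp
  with cg show ?thesis unfolding p_eq by blast
qed

end
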